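(* For the one-dimensional simple symmetric random walk $S_t$, for all integers $n\neq0$ and all $k=1,2,\ldots$, $$\mathsf{P}\left\{\overrightarrow{f}(n)=k\right\}=\frac12\mathsf{P}\{Z_{|n|-1}=k\},$$ $$\mathsf{P}\left\{\overleftarrow{f}(n)=k\right\}=\frac12\mathsf{P}\{Z_{|n|}=k\},$$ $$\mathsf{P}\left\{f(n)=k\right\}=\frac12\mathsf{P}\{Z_{|n|-1}+Z_{|n|}=k\},$$ and $$\mathsf{P}\left\{\overrightarrow{f}(n)=0\right\}=\frac12+\frac12\mathsf{P}\{Z_{|n|-1}=0\},$$ $$\mathsf{P}\left\{\overleftarrow{f}(n)=0\right\}=\frac12+\frac12\mathsf{P}\{Z_{|n|}=0\},$$ $$\mathsf{P}\left\{f(n)=0\right\}=\frac12+\frac12\mathsf{P}\{Z_{|n|-1}+Z_{|n|}=0\}.$$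
   Context: $S_t$ is the simple symmetric random walk in $\mathbb{Z}$ with $S_0=0$ and i.i.d. increments equal to $\pm1$ with probability $1/2$ each; $\tau$ is the first time $t\geq1$ with $S_t=0$ (finite with probability 1). For an integer $n\ne0$: $f(n)$ is the number of times $t$ with $0<t<\tau$ and $S_t=n$; $\overrightarrow{f}(n)$ (up-directed crossings) is the number of times $t$ with $0<t<\tau$, $S_t=n$ and $|S_{t-1}|=|n|-1$; $\overleftarrow{f}(n)$ (down-directed crossings) is the number of times $t$ with $0<t<\tau$, $S_t=n$ and $|S_{t-1}|=|n|+1$. $(Z_n)_{n\geq0}$ is the Galton–Watson branching process ($Z_n$ is the number of offspring in the $n$th generation) with $Z_0=1$ and offspring distribution $\mathsf{P}\{Z_1=k\}=1/2^{k+1}$, $k=0,1,\ldots$. *)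

theory Defs
  imports "HOL-Probability.Probability" "HOL-Library.Extended_Nat"
begin

locale simple_symmetric_walk = prob_space M
  for M :: "'a measure" +
  fixes S :: "nat \<Rightarrow> 'a \<Rightarrow> int"
  assumes start: "\<And>\<omega>. \<omega> \<in> space M \<Longrightarrow> S 0 \<omega> = 0"
    and indep_increments:
      "indep_vars (\<lambda>_. count_space UNIV) (\<lambda>t \<omega>. S (Suc t) \<omega> - S t \<omega>) UNIV"
    and increment_up: "\<And>t. \<P>(\<omega> in M. S (Suc t) \<omega> - S t \<omega> = 1) = 1 / 2"
    and increment_down: "\<And>t. \<P>(\<omega> in M. S (Suc t) \<omega> - S t \<omega> = - 1) = 1 / 2"

text \<open>
  \<open>\<xi> m i\<close> is the number of children of the \<open>i\<close>-th individual of generation \<open>m\<close>, and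
  \<open>q k\<close> is the probability of having \<open>k\<close> children. All \<open>\<xi> m i\<close> are jointly independent, so the
  joint law of \<open>Z\<close> is determined by \<open>q\<close>.
\<close>

locale galton_watson = prob_space N
  for N :: "'b measure" +
  fixes q :: "nat \<Rightarrow> real"
    and \<xi> :: "nat \<Rightarrow> nat \<Rightarrow> 'b \<Rightarrow> nat"
    and Z :: "nat \<Rightarrow> 'b \<Rightarrow> nat"
  assumes indep_offspring:
      "indep_vars (\<lambda>_. count_space UNIV) (\<lambda>(m, i). \<xi> m i) UNIV"
    and offspring_law: "\<And>m i k. \<P>(\<omega> in N. \<xi> m i \<omega> = k) = q k"
    and generation_0: "\<And>\<omega>. \<omega> \<in> space N \<Longrightarrow> Z 0 \<omega> = 1"
    and generation_Suc:
      "\<And>m \<omega>. \<omega> \<in> space N \<Longrightarrow> Z (Suc m) \<omega> = (\<Sum>i<Z m \<omega>. \<xi> m i \<omega>)"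

text \<open>The first return time to \<open>0\<close> is \<open>\<infinity>\<close> if there is no return (infimum of the empty set).\<close>

definition return_time :: "(nat \<Rightarrow> 'a \<Rightarrow> int) \<Rightarrow> 'a \<Rightarrow> enat" where
  "return_time S \<omega> = (INF t\<in>{t. 1 \<le> t \<and> S t \<omega> = 0}. enat t)"

text \<open>
  Counts are extended naturals: on the null event that the walk never returns, the number of
  visits can be infinite, whereas \<^const>\<open>card\<close> of an infinite set is \<open>0\<close>.
\<close>

definition number_of :: "nat set \<Rightarrow> enat" where
  "number_of T = (if finite T then enat (card T) else \<infinity>)"

definition visits :: "(nat \<Rightarrow> 'a \<Rightarrow> int) \<Rightarrow> int \<Rightarrow> 'a \<Rightarrow> enat" where
  "visits S n \<omega> = number_of {t. 0 < t \<and> enat t < return_time S \<omega> \<and> S t \<omega> = n}"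

definition up_crossings :: "(nat \<Rightarrow> 'a \<Rightarrow> int) \<Rightarrow> int \<Rightarrow> 'a \<Rightarrow> enat" where
  "up_crossings S n \<omega> = number_of
     {t. 0 < t \<and> enat t < return_time S \<omega> \<and> S t \<omega> = n \<and> \<bar>S (t - 1) \<omega>\<bar> = \<bar>n\<bar> - 1}"

definition down_crossings :: "(nat \<Rightarrow> 'a \<Rightarrow> int) \<Rightarrow> int \<Rightarrow> 'a \<Rightarrow> enat" where
  "down_crossings S n \<omega> = number_of
     {t. 0 < t \<and> enat t < return_time S \<omega> \<and> S t \<omega> = n \<and> \<bar>S (t - 1) \<omega>\<bar> = \<bar>n\<bar> + 1}"

end

theory Submission
  imports Defs
begin

text \<open>
  Let \<open>m = \<bar>n\<bar>\<close> and let \<open>a k\<close> be the probability that a walk started at \<open>n\<close> makes \<open>k\<close> further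
  passages to \<open>n\<close> of the chosen kind before it hits \<open>0\<close>. As a function of its starting point, such
  a law is harmonic away from \<open>n\<close>. Being bounded, it is constant beyond \<open>n\<close> and linear between
  \<open>0\<close> and \<open>n\<close>. The first step from \<open>n\<close> therefore gives a linear recursion for \<open>a\<close> alone, in
  which a counted passage shifts the index by one. Its generating function is rational, and the one
  this yields for an excursion that has stepped towards \<open>n\<close> agrees with that of a sum of \<open>Z (m - 1)\<close> and \<open>Z m\<close> (each with weight \<open>0\<close> or \<open>1\<close>), which follows from
  \<open>E t^Z\<^sub>m = 1 - (1 - t) / (m + 1 - m t)\<close>. Harmonic functions replace any appeal to recurrence:
  excursions that never end enter only through the bound by \<open>1\<close>.
\<close>

section \<open>Real sequences and power series\<close>

text \<open>The second differences vanish, so \<open>f\<close> is affine, and a nonzero slope would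
  eventually break the bound.\<close>

lemma bounded_harmonic_nat_const:
  fixes f :: "nat \<Rightarrow> real"
  assumes "\<And>j. \<bar>f j\<bar> \<le> C" and "\<And>j. f (Suc j) = (f j + f (Suc (Suc j))) / 2"
  shows "f j = f 0"
proof -
  define d where "d = f 1 - f 0"
  \<comment> \<open>The claim carries two consecutive values because the recursion has order
    two.\<close>
  have lin: "f j = f 0 + real j * d \<and> f (Suc j) = f 0 + real (Suc j) * d" for j
  proof (induction j)
    case (Suc j)
    then show ?case using assms(2)[of j] by (simp add: algebra_simps)
  qed (simp add: d_def)
  have "d = 0"
  proof (rule ccontr)
    assume "d \<noteq> 0"
    then obtain j :: nat where "2 * C < real j * \<bar>d\<bar>"
      using reals_Archimedean3[of "\<bar>d\<bar>"] by auto
    also have "\<dots> = \<bar>f j - f 0\<bar>" using lin[of j] by (simp add: abs_mult)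
    also have "\<dots> \<le> 2 * C" using assms(1)[of j] assms(1)[of 0] by linarith
    finally show False by simp
  qed
  then show ?thesis using lin[of j] by simp
qed

lemma harmonic_nat_linear:
  fixes f :: "nat \<Rightarrow> real"
  assumes harm: "\<And>j. Suc j < m \<Longrightarrow> f (Suc j) = (f j + f (Suc (Suc j))) / 2"
    and j: "j \<le> m" and m: "0 < m"
  shows "f j = (1 - real j / real m) * f 0 + real j / real m * f m"
proof -
  define d where "d = f 1 - f 0"
  have lin: "j < m \<longrightarrow> f j = f 0 + real j * d \<and> f (Suc j) = f 0 + real (Suc j) * d" for j
  proof (induction j)
    case (Suc j)
    then show ?case using harm[of j] by (auto simp: algebra_simps)
  qed (simp add: d_def)
  have lin': "f j = f 0 + real j * d" if "j \<le> m" for j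
    using lin[of "j - 1"] that m by (cases j) auto
  have "f m = f 0 + real m * d" by (rule lin') simp
  then show ?thesis using lin'[OF j] m by (simp add: field_simps)
qed

text \<open>Once the coefficients of the difference below \<open>n\<close> vanish, dividing by
  \<open>t ^ n\<close> leaves a series that sums to 0 whenever 0 < |t| < 1; its limit at 0 is the
  coefficient \<open>d n\<close>.\<close>

lemma power_series_unique:
  fixes a b :: "nat \<Rightarrow> real"
  assumes a: "\<And>t. \<bar>t\<bar> < 1 \<Longrightarrow> (\<lambda>k. a k * t ^ k) sums f t"
    and b: "\<And>t. \<bar>t\<bar> < 1 \<Longrightarrow> (\<lambda>k. b k * t ^ k) sums f t"
  shows "a = b"
proof -
  define d where "d k = a k - b k" for k
  have d: "(\<lambda>k. d k * t ^ k) sums 0" if "\<bar>t\<bar> < 1" for t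
    using sums_diff[OF a[OF that] b[OF that]] by (simp add: d_def algebra_simps)
  have "d n = 0" for n
  proof (induction n rule: less_induct)
    case (less n)
    have "(\<lambda>i. d (i + n) * t ^ i) sums 0" if "t \<noteq> 0" "norm t < 1" for t
    proof -
      have "(\<lambda>i. d (i + n) * t ^ (i + n)) sums 0"
        using sums_iff_shift[of "\<lambda>k. d k * t ^ k" n 0] d[of t] that less by simp
      from sums_mult[OF this, of "inverse (t ^ n)"] show ?thesis
        using that by (simp add: power_add field_simps)
    qed
    then have "((\<lambda>_. 0) \<longlongrightarrow> d (0 + n)) (at (0::real))"
      by (intro powser_limit_0_strong[where s = 1]) auto
    then show ?case by (simp add: tendsto_const_iff)
  qed
  then show ?thesis by (auto simp: d_def)
qed

lemma of_bool_0_sums: "(\<lambda>k. of_bool (k = 0) * t ^ k) sums (1::real)"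
  using powser_sums_if[of 0 t] by (simp add: of_bool_def)

text \<open>These are the coefficients of \<open>t ^ d\<close> times the power series of
  \<open>a\<close>; a counted passage is a delay by 1.\<close>

definition delay :: "nat \<Rightarrow> (nat \<Rightarrow> real) \<Rightarrow> nat \<Rightarrow> real" where
  "delay d a k = (if k < d then 0 else a (k - d))"

lemma sums_delayed:
  fixes a :: "nat \<Rightarrow> real"
  assumes "(\<lambda>k. a k * t ^ k) sums s"
  shows "(\<lambda>k. delay d a k * t ^ k) sums (t ^ d * s)"
proof -
  have "(\<lambda>k. a k * t ^ (k + d)) sums (t ^ d * s)"
    using sums_mult[OF assms, of "t ^ d"] by (simp add: power_add mult_ac)
  then show ?thesis
    using sums_iff_shift'[of "\<lambda>k. delay d a k * t ^ k" d] by (simp add: delay_def)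
qed

section \<open>The branching process\<close>

text \<open>This replaces conditioning on \<open>Y\<close> and never divides by the probability of
  \<open>Y = j\<close>. The partial sums collapse to the restriction to \<open>Y < n\<close>, and
  dominated convergence with the constant \<open>C\<close> gives the limit.\<close>

lemma (in prob_space) expectation_countable_partition:
  fixes Y :: "'a \<Rightarrow> nat" and f :: "nat \<Rightarrow> 'a \<Rightarrow> real"
  assumes Y: "Y \<in> measurable M (count_space UNIV)"
    and f: "\<And>j. f j \<in> borel_measurable M"
    and bound: "\<And>j \<omega>. \<bar>f j \<omega>\<bar> \<le> C"
  shows "(\<lambda>j. expectation (\<lambda>\<omega>. of_bool (Y \<omega> = j) * f j \<omega>)) sums expectation (\<lambda>\<omega>. f (Y \<omega>) \<omega>)"
proof -
  have meas[measurable]: "(\<lambda>\<omega>. f (Y \<omega>) \<omega>) \<in> borel_measurable M"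
    by (rule measurable_compose_countable[OF f Y])
  note Y[measurable] f[measurable]
  have part: "(\<Sum>j<n. of_bool (Y \<omega> = j) * f j \<omega>) = of_bool (Y \<omega> < n) * f (Y \<omega>) \<omega>" for n \<omega>
    by (induction n) (auto simp: less_Suc_eq)
  have int: "integrable M (\<lambda>\<omega>. of_bool (Y \<omega> = j) * f j \<omega>)" for j
    by (rule integrable_const_bound[of _ C]) (use bound in \<open>auto simp: abs_mult intro: order_trans[OF abs_ge_zero bound]\<close>)
  have "(\<lambda>n. expectation (\<lambda>\<omega>. of_bool (Y \<omega> < n) * f (Y \<omega>) \<omega>))
      \<longlonglongrightarrow> expectation (\<lambda>\<omega>. f (Y \<omega>) \<omega>)"
  proof (rule integral_dominated_convergence[where w = "\<lambda>_. C"])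
    show "AE \<omega> in M. (\<lambda>n. of_bool (Y \<omega> < n) * f (Y \<omega>) \<omega>) \<longlonglongrightarrow> f (Y \<omega>) \<omega>"
    proof (rule AE_I2)
      fix \<omega>
      have "eventually (\<lambda>n. f (Y \<omega>) \<omega> = of_bool (Y \<omega> < n) * f (Y \<omega>) \<omega>) sequentially"
        using eventually_gt_at_top[of "Y \<omega>"] by eventually_elim simp
      then show "(\<lambda>n. of_bool (Y \<omega> < n) * f (Y \<omega>) \<omega>) \<longlonglongrightarrow> f (Y \<omega>) \<omega>"
        by (rule Lim_transform_eventually[OF tendsto_const])
    qed
    show "AE \<omega> in M. norm (of_bool (Y \<omega> < n) * f (Y \<omega>) \<omega>) \<le> C" for n
      using bound by (auto simp: abs_mult intro: order_trans[OF abs_ge_zero bound])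
  qed simp_all
  then show ?thesis
    unfolding sums_def by (simp add: part int flip: Bochner_Integration.integral_sum)
qed

lemma (in prob_space) expectation_of_bool:
  assumes "{\<omega> \<in> space M. P \<omega>} \<in> events"
  shows "expectation (\<lambda>\<omega>. of_bool (P \<omega>)) = prob {\<omega> \<in> space M. P \<omega>}"
proof -
  have "expectation (\<lambda>\<omega>. of_bool (P \<omega>)) = expectation (indicator {\<omega> \<in> space M. P \<omega>})"
    by (intro Bochner_Integration.integral_cong) auto
  also have "\<dots> = prob {\<omega> \<in> space M. P \<omega>}"
    using assms by (subst Bochner_Integration.integral_indicator) (auto simp: Int_absorb2 sets.sets_into_space)
  finally show ?thesis .
qed

lemma (in prob_space) pgf_sums:
  assumes Y[measurable]: "Y \<in> measurable M (count_space UNIV)" and t: "\<bar>t\<bar> \<le> (1::real)"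
  shows "(\<lambda>k. prob {\<omega> \<in> space M. Y \<omega> = k} * t ^ k) sums expectation (\<lambda>\<omega>. t ^ Y \<omega>)"
proof -
  have "(\<lambda>k. expectation (\<lambda>\<omega>. of_bool (Y \<omega> = k) * t ^ k)) sums expectation (\<lambda>\<omega>. t ^ Y \<omega>)"
    by (rule expectation_countable_partition[OF Y, of _ 1])
      (use t in \<open>auto simp: power_abs intro: power_le_one\<close>)
  then show ?thesis by (simp add: expectation_of_bool)
qed

context galton_watson
begin

text \<open>Exhibits \<open>Z m\<close> as a function of the rows of the offspring array below
  \<open>m\<close>, so that its independence of row \<open>m\<close> can be used.\<close>

primrec population :: "nat \<Rightarrow> (nat \<times> nat \<Rightarrow> nat) \<Rightarrow> nat" where
  "population 0 x = 1"
| "population (Suc m) x = (\<Sum>i<population m x. x (m, i))"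

lemma measurable_population:
  "m \<le> m' \<Longrightarrow> population m \<in>
    measurable (PiM ({..<m'} \<times> UNIV) (\<lambda>_. count_space UNIV)) (count_space UNIV)"
proof (induction m)
  case (Suc m)
  then have [measurable]: "(\<lambda>x. x (m, i)) \<in>
      measurable (PiM ({..<m'} \<times> UNIV) (\<lambda>_. count_space UNIV)) (count_space UNIV)" for i
    by (intro measurable_component_singleton) auto
  show ?case
    unfolding population.simps
    by (rule measurable_compose_countable[where f = "\<lambda>j x. \<Sum>i<j. x (m, i)"]) (use Suc in auto)
next
  case 0
  have "population 0 = (\<lambda>_. 1)" by auto
  then show ?case by simp
qed

lemma Z_eq_population:
  assumes "\<omega> \<in> space N" "m \<le> m'"
  shows "Z m \<omega> = population m (restrict (\<lambda>p. (case p of (m, i) \<Rightarrow> \<xi> m i) \<omega>) ({..<m'} \<times> UNIV))"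
  using assms(2) by (induction m) (simp_all add: generation_0 generation_Suc assms(1))

lemma random_offspring: "random_variable (count_space UNIV) (\<xi> m i)"
  using indep_offspring by (auto simp: indep_vars_def)

lemma random_Z: "random_variable (count_space UNIV) (Z m)"
proof -
  have "(\<lambda>\<omega>. population m (restrict (\<lambda>p. (case p of (m, i) \<Rightarrow> \<xi> m i) \<omega>) ({..<m} \<times> UNIV)))
      \<in> measurable N (count_space UNIV)"
    by (rule measurable_compose[OF _ measurable_population[OF order.refl]])
      (auto intro!: measurable_restrict random_offspring)
  then show ?thesis
    by (subst measurable_cong[OF Z_eq_population[OF _ order.refl]]) auto
qed

text \<open>\<open>Z m\<close> depends on the rows below \<open>m\<close> and the product on row
  \<open>m\<close>: disjoint index blocks, hence independent.\<close>

lemma expectation_generation_split: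
  fixes t :: real
  assumes t: "\<bar>t\<bar> \<le> 1"
  shows "expectation (\<lambda>\<omega>. of_bool (Z m \<omega> = j) * (\<Prod>i<j. t ^ \<xi> m i \<omega>))
    = prob {\<omega> \<in> space N. Z m \<omega> = j} * (\<Prod>i<j. expectation (\<lambda>\<omega>. t ^ \<xi> m i \<omega>))"
proof -
  let ?X = "\<lambda>p. case p of (m, i) \<Rightarrow> \<xi> m i"
  note random_Z[measurable] random_offspring[measurable]
  have "indep_var (PiM ({..<m} \<times> UNIV) (\<lambda>_. count_space UNIV))
      (\<lambda>\<omega>. restrict (\<lambda>p. ?X p \<omega>) ({..<m} \<times> UNIV))
      (PiM ({m} \<times> UNIV) (\<lambda>_. count_space UNIV))
      (\<lambda>\<omega>. restrict (\<lambda>p. ?X p \<omega>) ({m} \<times> UNIV))"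
    by (rule indep_var_restrict[OF indep_offspring]) auto
  then have "indep_var borel ((\<lambda>x. of_bool (population m x = j) :: real) \<circ>
        (\<lambda>\<omega>. restrict (\<lambda>p. ?X p \<omega>) ({..<m} \<times> UNIV)))
      borel ((\<lambda>x. \<Prod>i<j. t ^ x (m, i)) \<circ> (\<lambda>\<omega>. restrict (\<lambda>p. ?X p \<omega>) ({m} \<times> UNIV)))"
  proof (rule indep_var_compose)
    note measurable_population[OF order.refl, measurable]
    show "(\<lambda>x. of_bool (population m x = j) :: real) \<in>
        borel_measurable (PiM ({..<m} \<times> UNIV) (\<lambda>_. count_space UNIV))"
      by measurable
    have [measurable]: "(\<lambda>x. x (m, i)) \<in>
        measurable (PiM ({m} \<times> UNIV) (\<lambda>_. count_space UNIV)) (count_space UNIV)" for i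
      by (intro measurable_component_singleton) auto
    show "(\<lambda>x. \<Prod>i<j. t ^ x (m, i)) \<in>
        borel_measurable (PiM ({m} \<times> UNIV) (\<lambda>_. count_space UNIV))"
      by measurable
  qed
  then have indep: "indep_var borel (\<lambda>\<omega>. of_bool (population m
        (restrict (\<lambda>p. ?X p \<omega>) ({..<m} \<times> UNIV)) = j) :: real)
      borel (\<lambda>\<omega>. \<Prod>i<j. t ^ \<xi> m i \<omega>)"
    by (simp add: comp_def)
  have bound: "\<bar>\<Prod>i<j. t ^ \<xi> m i \<omega>\<bar> \<le> 1" for \<omega>
    using t by (auto simp: abs_prod power_abs intro!: prod_le_1 power_le_one)
  have "expectation (\<lambda>\<omega>. of_bool (Z m \<omega> = j) * (\<Prod>i<j. t ^ \<xi> m i \<omega>))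
    = expectation (\<lambda>\<omega>. of_bool (population m
        (restrict (\<lambda>p. ?X p \<omega>) ({..<m} \<times> UNIV)) = j) * (\<Prod>i<j. t ^ \<xi> m i \<omega>))"
    by (intro Bochner_Integration.integral_cong) (simp_all add: Z_eq_population[of _ m m])
  also have "\<dots> = expectation (\<lambda>\<omega>. of_bool (population m
        (restrict (\<lambda>p. ?X p \<omega>) ({..<m} \<times> UNIV)) = j)) * expectation (\<lambda>\<omega>. \<Prod>i<j. t ^ \<xi> m i \<omega>)"
    by (rule indep_var_lebesgue_integral[OF indep])
      (auto intro!: integrable_const_bound[of _ 1] bound indep_var_rv1[OF indep])
  also have "expectation (\<lambda>\<omega>. of_bool (population m
        (restrict (\<lambda>p. ?X p \<omega>) ({..<m} \<times> UNIV)) = j)) = expectation (\<lambda>\<omega>. of_bool (Z m \<omega> = j))"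
    by (intro Bochner_Integration.integral_cong) (simp_all add: Z_eq_population[of _ m m])
  also have "\<dots> = prob {\<omega> \<in> space N. Z m \<omega> = j}"
    by (rule expectation_of_bool) measurable
  also have "expectation (\<lambda>\<omega>. \<Prod>i<j. t ^ \<xi> m i \<omega>) = (\<Prod>i<j. expectation (\<lambda>\<omega>. t ^ \<xi> m i \<omega>))"
  proof -
    \<comment> \<open>Independence is used a second time, now among the individuals of the single
      row \<open>m\<close>.\<close>
    have "indep_vars (\<lambda>_. borel) (\<lambda>p \<omega>. t ^ ?X p \<omega>) (Pair m ` {..<j})"
      by (rule indep_vars_compose2[OF indep_vars_subset[OF indep_offspring]]) auto
    then have "expectation (\<lambda>\<omega>. \<Prod>p\<in>Pair m ` {..<j}. t ^ ?X p \<omega>)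
        = (\<Prod>p\<in>Pair m ` {..<j}. expectation (\<lambda>\<omega>. t ^ ?X p \<omega>))"
      by (rule indep_vars_lebesgue_integral[rotated])
        (use t in \<open>auto intro!: integrable_const_bound[of _ 1] AE_I2 power_le_one simp: power_abs\<close>)
    then show ?thesis by (simp add: prod.reindex inj_on_def)
  qed
  finally show ?thesis .
qed

text \<open>On \<open>Z m = j\<close> the next generation is a sum of \<open>j\<close> offspring
  numbers, independent of that event and each with generating function value \<open>g\<close>, so
  \<open>t ^ Z (Suc m)\<close> contributes \<open>g ^ j\<close>.\<close>

lemma joint_pgf:
  fixes s t :: real
  assumes s: "\<bar>s\<bar> \<le> 1" and t: "\<bar>t\<bar> \<le> 1"
    and g: "\<And>i. expectation (\<lambda>\<omega>. t ^ \<xi> m i \<omega>) = g" "\<bar>g\<bar> \<le> 1"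
  shows "expectation (\<lambda>\<omega>. s ^ Z m \<omega> * t ^ Z (Suc m) \<omega>) = expectation (\<lambda>\<omega>. (s * g) ^ Z m \<omega>)"
proof -
  note random_Z[measurable] random_offspring[measurable]
  let ?f = "\<lambda>j \<omega>. s ^ j * (\<Prod>i<j. t ^ \<xi> m i \<omega>)"
  have "(\<lambda>j. expectation (\<lambda>\<omega>. of_bool (Z m \<omega> = j) * ?f j \<omega>))
      sums expectation (\<lambda>\<omega>. ?f (Z m \<omega>) \<omega>)"
  proof (rule expectation_countable_partition[OF random_Z, of _ 1])
    show "\<bar>?f j \<omega>\<bar> \<le> 1" for j \<omega>
      using s t by (auto simp: abs_mult abs_prod power_abs intro!: mult_le_one prod_le_1 power_le_one prod_nonneg)
  qed measurable
  moreover have "expectation (\<lambda>\<omega>. of_bool (Z m \<omega> = j) * ?f j \<omega>)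
      = prob {\<omega> \<in> space N. Z m \<omega> = j} * (s * g) ^ j" for j
  proof -
    have "expectation (\<lambda>\<omega>. of_bool (Z m \<omega> = j) * ?f j \<omega>)
        = expectation (\<lambda>\<omega>. s ^ j * (of_bool (Z m \<omega> = j) * (\<Prod>i<j. t ^ \<xi> m i \<omega>)))"
      by (simp only: mult_ac)
    also have "\<dots> = s ^ j * (prob {\<omega> \<in> space N. Z m \<omega> = j} * g ^ j)"
      using expectation_generation_split[OF t] g by simp
    finally show ?thesis by (simp add: power_mult_distrib)
  qed
  moreover have "expectation (\<lambda>\<omega>. ?f (Z m \<omega>) \<omega>)
      = expectation (\<lambda>\<omega>. s ^ Z m \<omega> * t ^ Z (Suc m) \<omega>)"
    by (intro Bochner_Integration.integral_cong) (simp_all add: generation_Suc power_sum)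
  moreover have "(\<lambda>j. prob {\<omega> \<in> space N. Z m \<omega> = j} * (s * g) ^ j)
      sums expectation (\<lambda>\<omega>. (s * g) ^ Z m \<omega>)"
    by (rule pgf_sums[OF random_Z]) (use s g in \<open>auto simp: abs_mult intro: mult_le_one\<close>)
  ultimately show ?thesis by (simp add: sums_unique2)
qed

end

section \<open>Generating functions for geometric offspring\<close>

locale geometric_galton_watson = galton_watson N "\<lambda>k. 1 / 2 ^ (k + 1)" \<xi> Z
  for N :: "'b measure" and \<xi> Z
begin

lemma offspring_pgf:
  assumes t: "\<bar>t\<bar> \<le> (1::real)"
  shows "expectation (\<lambda>\<omega>. t ^ \<xi> m i \<omega>) = 1 / (2 - t)"
proof -
  have "(\<lambda>k. 1 / 2 ^ (k + 1) * t ^ k) sums expectation (\<lambda>\<omega>. t ^ \<xi> m i \<omega>)"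
    using pgf_sums[OF random_offspring t] by (simp add: offspring_law)
  moreover have "(\<lambda>k. 1 / 2 * (t / 2) ^ k) sums (1 / 2 * (1 / (1 - t / 2)))"
    by (intro sums_mult geometric_sums) (use t in auto)
  ultimately have "expectation (\<lambda>\<omega>. t ^ \<xi> m i \<omega>) = 1 / 2 * (1 / (1 - t / 2))"
    by (simp add: power_divide sums_unique2)
  then show ?thesis using t by (simp add: field_simps)
qed

text \<open>One generation replaces \<open>t\<close> by \<open>1 / (2 - t)\<close>. In the
  coordinate \<open>1 / (1 - t)\<close> this map is translation by 1, which explains the closed
  form.\<close>

lemma Z_pgf:
  assumes "\<bar>t\<bar> \<le> (1::real)"
  shows "expectation (\<lambda>\<omega>. t ^ Z m \<omega>) = 1 - (1 - t) / (m + 1 - m * t)"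
  using assms
proof (induction m arbitrary: t)
  case 0
  have "expectation (\<lambda>\<omega>. t ^ Z 0 \<omega>) = expectation (\<lambda>\<omega>. t)"
    by (intro Bochner_Integration.integral_cong) (simp_all add: generation_0)
  then show ?case by (simp add: prob_space)
next
  case (Suc m)
  have g: "\<bar>1 / (2 - t)\<bar> \<le> 1" using Suc.prems by simp
  have "expectation (\<lambda>\<omega>. t ^ Z (Suc m) \<omega>) = expectation (\<lambda>\<omega>. (1 / (2 - t)) ^ Z m \<omega>)"
    using joint_pgf[of 1 t, OF _ Suc.prems offspring_pgf[OF Suc.prems] g] by simp
  also have "\<dots> = 1 - (1 - 1 / (2 - t)) / (m + 1 - m * (1 / (2 - t)))"
    by (rule Suc.IH[OF g])
  also have "\<dots> = 1 - (1 - t) / (Suc m + 1 - Suc m * t)"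
  proof -
    have "1 - 1 / (2 - t) = (1 - t) / (2 - t)"
      "m + 1 - m * (1 / (2 - t)) = (Suc m + 1 - Suc m * t) / (2 - t)"
      using Suc.prems by (auto simp: field_simps)
    then show ?thesis using Suc.prems by simp
  qed
  finally show ?case .
qed

text \<open>\<open>Z_pgf\<close> at \<open>s / (2 - t)\<close>, with numerator and denominator then
  cleared of the factor \<open>2 - t\<close>.\<close>

lemma consecutive_pgf:
  fixes s t :: real
  assumes s: "\<bar>s\<bar> \<le> 1" and t: "\<bar>t\<bar> \<le> 1"
  shows "expectation (\<lambda>\<omega>. s ^ Z m \<omega> * t ^ Z (Suc m) \<omega>)
    = 1 - (2 - t - s) / (real (m + 1) * (2 - t) - m * s)"
proof -
  have g: "\<bar>1 / (2 - t)\<bar> \<le> 1" using t by simp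
  have sg: "\<bar>s * (1 / (2 - t))\<bar> \<le> 1" using mult_le_one[OF s _ g] by (simp add: abs_mult)
  have "expectation (\<lambda>\<omega>. s ^ Z m \<omega> * t ^ Z (Suc m) \<omega>)
      = 1 - (1 - s * (1 / (2 - t))) / (m + 1 - m * (s * (1 / (2 - t))))"
    by (simp only: joint_pgf[OF s t offspring_pgf[OF t] g] Z_pgf[OF sg])
  also have "\<dots> = 1 - (2 - t - s) / (real (m + 1) * (2 - t) - m * s)"
  proof -
    have "1 - s * (1 / (2 - t)) = (2 - t - s) / (2 - t)"
      "m + 1 - m * (s * (1 / (2 - t))) = (real (m + 1) * (2 - t) - m * s) / (2 - t)"
      using t by (auto simp: field_simps)
    then show ?thesis using t by simp
  qed
  finally show ?thesis .
qed

end

section \<open>Counting passages of an excursion\<close>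

lemma number_of_Suc_image: "number_of (Suc ` T) = number_of T"
  by (auto simp: number_of_def card_image finite_image_iff)

lemma number_of_empty: "number_of {} = 0"
  by (simp add: number_of_def zero_enat_def)

lemma number_of_insert_Suc:
  assumes "0 \<notin> T"
  shows "number_of (insert (Suc 0) (Suc ` T)) = eSuc (number_of T)"
proof -
  have "Suc 0 \<notin> Suc ` T" using assms by auto
  then show ?thesis
    by (auto simp: number_of_def card_image finite_image_iff eSuc_enat)
qed

text \<open>Only countably many sets \<open>F\<close> qualify, which makes events about counts
  measurable.\<close>

lemma number_of_eq_enat_iff: "number_of T = enat k \<longleftrightarrow> (\<exists>F\<in>{F. finite F \<and> card F = k}. T = F)"
  by (auto simp: number_of_def)

lemma less_return_time_iff: "enat t < return_time S \<omega> \<longleftrightarrow> (\<forall>s\<in>{1..t}. S s \<omega> \<noteq> 0)"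
proof -
  \<comment> \<open>Passing to \<open>Suc t\<close> gives a strict bound on the infimum, which some
    element of the set must then satisfy.\<close>
  have "\<not> enat t < return_time S \<omega> \<longleftrightarrow> return_time S \<omega> < enat (Suc t)"
    by (cases "return_time S \<omega>") auto
  also have "\<dots> \<longleftrightarrow> (\<exists>s\<in>{s. 1 \<le> s \<and> S s \<omega> = 0}. enat s < enat (Suc t))"
    unfolding return_time_def by (rule INF_less_iff)
  finally show ?thesis by auto
qed

text \<open>
  \<open>R\<close> restricts the distance from \<open>0\<close> of the site from which \<open>n\<close> is entered, so that up-crossings,
  down-crossings and visits are all instances.
\<close>

definition passages :: "(int \<Rightarrow> bool) \<Rightarrow> int \<Rightarrow> (nat \<Rightarrow> int) \<Rightarrow> enat" where
  "passages R n g = number_of {t. 0 < t \<and> (\<forall>s\<in>{1..t}. g s \<noteq> 0) \<and> g t = n \<and> R \<bar>g (t - 1)\<bar>}"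

text \<open>Prepending the site \<open>a\<close> shifts time by one. The only new candidate is the
  arrival at \<open>g 0\<close> at time 1, and \<open>g 0 = 0\<close> ends the excursion before
  anything is counted.\<close>

lemma passages_case_nat:
  "passages R n (case_nat a g) =
    (if g 0 = 0 then 0 else if g 0 = n \<and> R \<bar>a\<bar> then eSuc (passages R n g) else passages R n g)"
proof -
  let ?P = "\<lambda>g t. 0 < t \<and> (\<forall>s\<in>{1..t}. g s \<noteq> (0::int)) \<and> g t = n \<and> R \<bar>g (t - 1)\<bar>"
  \<comment> \<open>For \<open>t = 0\<close> the preceding site is \<open>a\<close> itself; for
    larger \<open>t\<close> it is \<open>g (t - 1)\<close>.\<close>
  have P: "?P (case_nat a g) (Suc t) \<longleftrightarrow>
      g 0 \<noteq> 0 \<and> (if t = 0 then g 0 = n \<and> R \<bar>a\<bar> else ?P g t)" for t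
  proof (cases t)
    case (Suc u)
    have "(\<forall>s\<in>{1..Suc t}. case_nat a g s \<noteq> 0) \<longleftrightarrow> (\<forall>s\<in>insert 0 {1..t}. g s \<noteq> 0)"
    proof -
      have "{1..Suc t} = Suc ` {..t}" by (rule image_Suc_atMost[symmetric, unfolded One_nat_def[symmetric]])
      then have "(\<forall>s\<in>{1..Suc t}. case_nat a g s \<noteq> 0) \<longleftrightarrow> (\<forall>s\<in>{..t}. g s \<noteq> 0)"
        by (auto simp del: image_Suc_atMost)
      also have "{..t} = insert 0 {1..t}" by auto
      finally show ?thesis .
    qed
    then show ?thesis unfolding Suc by simp
  qed auto
  have set: "{t. ?P (case_nat a g) t} = (if g 0 = 0 then {} else
      (if g 0 = n \<and> R \<bar>a\<bar> then insert (Suc 0) else id) (Suc ` {t. ?P g t}))"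
  proof (rule set_eqI)
    fix t show "t \<in> {t. ?P (case_nat a g) t} \<longleftrightarrow> t \<in> (if g 0 = 0 then {} else
      (if g 0 = n \<and> R \<bar>a\<bar> then insert (Suc 0) else id) (Suc ` {t. ?P g t}))"
    proof (cases t)
      case (Suc u)
      then show ?thesis
        unfolding Suc mem_Collect_eq P by (auto simp: inj_image_mem_iff)
    qed auto
  qed
  show ?thesis
    unfolding passages_def set
    by (simp add: number_of_insert_Suc number_of_Suc_image number_of_empty)
qed

section \<open>The walk as a function of its increments\<close>

definition walk :: "int \<Rightarrow> (nat \<Rightarrow> int) \<Rightarrow> nat \<Rightarrow> int" where
  "walk a x t = a + (\<Sum>i<t. x i)"

lemma walk_0 [simp]: "walk a x 0 = a"
  by (simp add: walk_def)

lemma walk_case_nat: "walk a (case_nat s x) = case_nat a (walk (a + s) x)"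
  by (auto simp: walk_def fun_eq_iff sum.lessThan_Suc_shift simp del: sum.lessThan_Suc split: nat.split)

text \<open>The canonical law of the increments. On sequence space the first increment can be split
  off by \<open>case_nat\<close>.\<close>

definition coins :: "(nat \<Rightarrow> int) measure" where
  "coins = PiM UNIV (\<lambda>_. measure_pmf (pmf_of_set {1, -1}))"

interpretation coin_space: sequence_space "measure_pmf (pmf_of_set {1, -1 :: int})"
  by standard

interpretation coins: prob_space coins
  unfolding coins_def by (rule prob_space_PiM) (rule measure_pmf.prob_space_axioms)

lemma space_coins [simp]: "space coins = UNIV"
  by (simp add: coins_def space_PiM)

text \<open>A coin sequence is one coin followed by an independent sequence of the same law; Fubini
  then averages over the two values of that coin.\<close>

lemma coins_first_step:
  assumes A: "A \<in> sets coins"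
  shows "measure coins A =
    (measure coins {x. case_nat 1 x \<in> A} + measure coins {x. case_nat (- 1) x \<in> A}) / 2"
proof -
  let ?P = "measure_pmf (pmf_of_set {1, -1 :: int})"
  let ?f = "\<lambda>(s, x). case_nat s x :: nat \<Rightarrow> int"
  have f: "?f \<in> measurable (?P \<Otimes>\<^sub>M coins) coins"
    unfolding coins_def by measurable
  have "emeasure coins A = emeasure (distr (?P \<Otimes>\<^sub>M coins) coins ?f) A"
    unfolding coins_def coin_space.PiM_iter ..
  also have "\<dots> = emeasure (?P \<Otimes>\<^sub>M coins) (?f -` A \<inter> space (?P \<Otimes>\<^sub>M coins))"
    using f A by (rule emeasure_distr)
  also have "\<dots> = (\<integral>\<^sup>+s. emeasure coins (Pair s -` (?f -` A \<inter> space (?P \<Otimes>\<^sub>M coins))) \<partial>?P)"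
    by (rule coins.emeasure_pair_measure_alt) (rule measurable_sets[OF f A])
  also have "\<dots> = (\<integral>\<^sup>+s. ennreal (measure coins {x. case_nat s x \<in> A}) \<partial>?P)"
    by (intro nn_integral_cong) (simp add: coins.emeasure_eq_measure vimage_def space_pair_measure)
  also have "\<dots> = (\<Sum>s\<in>{1, -1}. ennreal (measure coins {x. case_nat s x \<in> A})) / 2"
    by (subst nn_integral_pmf_of_set) (simp_all add: card_insert_if)
  also have "\<dots> = ennreal ((measure coins {x. case_nat 1 x \<in> A}
      + measure coins {x. case_nat (- 1) x \<in> A}) / 2)"
    by (simp flip: ennreal_plus ennreal_numeral add: divide_ennreal)
  finally show ?thesis
    by (simp add: coins.emeasure_eq_measure)
qed

lemma measurable_walk [measurable]: "(\<lambda>x. walk a x t) \<in> measurable coins (count_space UNIV)"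
proof -
  have [measurable]: "(\<lambda>x. x i) \<in> measurable coins (count_space UNIV)" for i
    unfolding coins_def by measurable
  show ?thesis
  proof (induction t)
    case (Suc t)
    have "(\<lambda>x. walk a x t + x t) \<in> measurable coins (count_space UNIV)"
      by (rule measurable_compose_countable[OF _ Suc]) measurable
    then show ?case by (simp add: walk_def add.assoc)
  qed simp
qed

lemma sets_passages [measurable]: "{x. passages R n (walk a x) = enat k} \<in> sets coins"
proof -
  have "countable {F :: nat set. finite F \<and> card F = k}"
    by (rule countable_subset[OF _ countable_Collect_finite]) auto
  then have "Measurable.pred coins (\<lambda>x. \<exists>F\<in>{F. finite F \<and> card F = k}. \<forall>t.
      (0 < t \<and> (\<forall>s\<in>{1..t}. walk a x s \<noteq> 0) \<and> walk a x t = n \<and> R \<bar>walk a x (t - 1)\<bar>) \<longleftrightarrow> t \<in> F)"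
    by measurable
  then show ?thesis
    unfolding passages_def number_of_eq_enat_iff set_eq_iff pred_def by simp
qed

text \<open>The path is a function of its increments, whose joint law is \<open>coins\<close> by
  independence and the marginals.\<close>

lemma (in simple_symmetric_walk) prob_passages:
  "\<P>(\<omega> in M. passages R n (\<lambda>t. S t \<omega>) = enat k) = measure coins {x. passages R n (walk 0 x) = enat k}"
proof -
  let ?X = "\<lambda>t \<omega>. S (Suc t) \<omega> - S t \<omega>"
  let ?P = "measure_pmf (pmf_of_set {1, -1 :: int})"
  have rv[measurable]: "random_variable (count_space UNIV) (?X t)" for t
    using indep_increments by (auto simp: indep_vars_def)
  have law: "distr M (count_space UNIV) (?X t) = ?P" for t
  proof (rule measure_eqI_countable[where A = UNIV])
    fix a :: int
    have single: "emeasure (distr M (count_space UNIV) (?X t)) {a} = \<P>(\<omega> in M. ?X t \<omega> = a)"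
      by (subst emeasure_distr) (auto simp: emeasure_eq_measure intro!: arg_cong[where f = prob])
    have "\<P>(\<omega> in M. ?X t \<omega> = a) = pmf (pmf_of_set {1, -1}) a"
    proof (cases "a \<in> {1, -1}")
      case True
      then show ?thesis using increment_up[of t] increment_down[of t] by auto
    next
      case False
      \<comment> \<open>The values 1 and -1 already carry total mass 1, so any other increment has
        probability 0.\<close>
      let ?E = "\<lambda>a. {\<omega> \<in> space M. ?X t \<omega> = a}"
      have "prob (?E a \<union> (?E 1 \<union> ?E (- 1))) = prob (?E a) + prob (?E 1 \<union> ?E (- 1))"
        by (rule finite_measure_Union) (use False in auto)
      also have "prob (?E 1 \<union> ?E (- 1)) = prob (?E 1) + prob (?E (- 1))"
        by (rule finite_measure_Union) auto
      finally have "prob (?E a) + 1 \<le> 1"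
        using increment_up[of t] increment_down[of t] prob_le_1[of "?E a \<union> (?E 1 \<union> ?E (- 1))"]
        by linarith
      then have "prob (?E a) = 0"
        using measure_nonneg[of M "?E a"] by linarith
      then show ?thesis using False by simp
    qed
    then show "emeasure (distr M (count_space UNIV) (?X t)) {a} = emeasure ?P {a}"
      by (simp add: single emeasure_pmf_single)
  qed auto
  have sets: "sets coins = sets (PiM UNIV (\<lambda>_. count_space (UNIV :: int set)))"
    unfolding coins_def by (intro sets_PiM_cong) auto
  have "distr M coins (\<lambda>\<omega> t. ?X t \<omega>)
      = distr M (PiM UNIV (\<lambda>_. count_space UNIV)) (\<lambda>\<omega>. \<lambda>t\<in>UNIV. ?X t \<omega>)"
    by (rule distr_cong) (simp_all add: sets restrict_def)
  also have "\<dots> = coins"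
    using indep_vars_iff_distr_eq_PiM[THEN iffD1, OF _ _ indep_increments] law
    by (simp add: coins_def)
  finally have distr: "distr M coins (\<lambda>\<omega> t. ?X t \<omega>) = coins" .
  have meas: "(\<lambda>\<omega> t. ?X t \<omega>) \<in> measurable M coins"
    unfolding measurable_cong_sets[OF refl sets] by (intro measurable_PiM_single') (auto simp: rv)
  have "walk 0 (\<lambda>t. ?X t \<omega>) = (\<lambda>t. S t \<omega>)" if "\<omega> \<in> space M" for \<omega>
    using sum_lessThan_telescope[of "\<lambda>i. S i \<omega>"] by (simp add: walk_def fun_eq_iff start[OF that])
  then have "{\<omega> \<in> space M. passages R n (\<lambda>t. S t \<omega>) = enat k}
      = (\<lambda>\<omega> t. ?X t \<omega>) -` {x. passages R n (walk 0 x) = enat k} \<inter> space M"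
    by auto
  then have "\<P>(\<omega> in M. passages R n (\<lambda>t. S t \<omega>) = enat k)
      = measure (distr M coins (\<lambda>\<omega> t. ?X t \<omega>)) {x. passages R n (walk 0 x) = enat k}"
    by (simp add: measure_distr[OF meas sets_passages])
  then show ?thesis unfolding distr .
qed

section \<open>First-step analysis\<close>

text \<open>At \<open>b = 0\<close> the excursion is over, whereas \<^const>\<open>passages\<close> would count those of a new one.\<close>

definition passage_prob :: "(int \<Rightarrow> bool) \<Rightarrow> int \<Rightarrow> int \<Rightarrow> nat \<Rightarrow> real" where
  "passage_prob R n b k =
    (if b = 0 then of_bool (k = 0) else measure coins {x. passages R n (walk b x) = enat k})"

lemma passage_prob_0 [simp]: "passage_prob R n 0 k = of_bool (k = 0)"
  by (simp add: passage_prob_def)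

lemma abs_passage_prob_le: "\<bar>passage_prob R n b k\<bar> \<le> 1"
  by (simp add: passage_prob_def)

text \<open>The law of the count from the step \<open>a\<close> to \<open>b\<close> onwards, that
  step included; hence the dependence on \<open>a\<close>.\<close>

definition arrival_prob :: "(int \<Rightarrow> bool) \<Rightarrow> int \<Rightarrow> int \<Rightarrow> int \<Rightarrow> nat \<Rightarrow> real" where
  "arrival_prob R n a b = delay (of_bool (b = n \<and> R \<bar>a\<bar>)) (passage_prob R n b)"

lemma arrival_prob_other: "b \<noteq> n \<Longrightarrow> arrival_prob R n a b = passage_prob R n b"
  by (simp add: arrival_prob_def delay_def fun_eq_iff)

text \<open>The start \<open>a = 0\<close> is allowed here, as the first step of the excursion
  itself requires; \<open>passage_prob\<close> is cut off at 0.\<close>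

lemma passages_first_step:
  assumes "n \<noteq> 0"
  shows "measure coins {x. passages R n (walk a x) = enat k} =
    (arrival_prob R n a (a + 1) k + arrival_prob R n a (a - 1) k) / 2"
proof -
  have "measure coins {x. case_nat s x \<in> {x. passages R n (walk a x) = enat k}}
      = arrival_prob R n a (a + s) k" for s
  proof -
    have eSuc: "eSuc e = enat k \<longleftrightarrow> k \<noteq> 0 \<and> e = enat (k - 1)" for e k
      by (cases k; cases e) (auto simp: eSuc_enat zero_enat_def)
    show ?thesis
      using assms coins.prob_space
      by (auto simp: walk_case_nat passages_case_nat eSuc arrival_prob_def delay_def
          passage_prob_def zero_enat_def)
  qed
  from this[of 1] this[of "-1"] show ?thesis
    by (subst coins_first_step[OF sets_passages]) simp
qed

lemma passage_prob_step:
  assumes "n \<noteq> 0" "b \<noteq> 0"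
  shows "passage_prob R n b k = (arrival_prob R n b (b + 1) k + arrival_prob R n b (b - 1) k) / 2"
  using passages_first_step[OF assms(1)] assms(2) by (simp add: passage_prob_def)

section \<open>The law of the count as a function of the starting site\<close>

locale passage_target =
  fixes R :: "int \<Rightarrow> bool" and n :: int
  assumes n: "n \<noteq> 0"
begin

definition m :: nat where "m = nat \<bar>n\<bar>"

text \<open>The factor \<open>sgn n\<close> places \<open>n\<close> at \<open>j = m\<close>, so both
  signs of \<open>n\<close> are treated at once.\<close>

definition H :: "nat \<Rightarrow> nat \<Rightarrow> real" where
  "H j = passage_prob R n (sgn n * int j)"

text \<open>Serves both as the index shift for an arrival from the side of 0 and as the multiplicity
  of \<open>Z (m - 1)\<close>; \<open>down_weight\<close> does the same for the far side and
  \<open>Z m\<close>.\<close>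

definition up_weight :: nat where "up_weight = of_bool (R (\<bar>n\<bar> - 1))"

definition down_weight :: nat where "down_weight = of_bool (R (\<bar>n\<bar> + 1))"

lemma m_pos: "0 < m"
  using n by (simp add: m_def)

lemma sgn_mult_eq_n: "sgn n * int j = n \<longleftrightarrow> j = m"
  using n by (cases "0 < n") (auto simp: m_def)

lemma arrival_other: "j \<noteq> m \<Longrightarrow> arrival_prob R n a (sgn n * int j) = H j"
  by (simp add: arrival_prob_other sgn_mult_eq_n H_def)

lemma arrival_target:
  "arrival_prob R n (sgn n * int i) (sgn n * int m) = delay (of_bool (R (int i))) (H m)"
proof -
  have "sgn n * int m = n" using sgn_mult_eq_n by simp
  moreover have "\<bar>sgn n * int i\<bar> = int i" using n by (simp add: abs_mult abs_sgn_eq)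
  ultimately show ?thesis by (simp add: arrival_prob_def H_def)
qed

lemma H_step:
  "H (Suc j) k = (arrival_prob R n (sgn n * int (Suc j)) (sgn n * int (Suc (Suc j))) k
    + arrival_prob R n (sgn n * int (Suc j)) (sgn n * int j) k) / 2"
  using n passage_prob_step[OF n, of "sgn n * int (Suc j)" R k]
  by (cases "0 < n") (simp_all add: H_def algebra_simps)

lemma H_above: "H (Suc m) k = delay down_weight (H m) k"
proof -
  \<comment> \<open>At \<open>n\<close> itself the value is what an arrival from beyond is worth,
    not \<open>H m\<close>; this makes \<open>f\<close> harmonic at the neighbouring site.\<close>
  define f where "f i = (if i = 0 then delay down_weight (H m) k else H (m + i) k)" for i
  have "f (Suc 0) = f 0"
  proof (rule bounded_harmonic_nat_const[where C = 1])
    show "\<bar>f j\<bar> \<le> 1" for j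
      using abs_passage_prob_le by (auto simp: f_def delay_def H_def)
    show "f (Suc j) = (f j + f (Suc (Suc j))) / 2" for j
    proof (cases j)
      case 0
      have "int (Suc m) = \<bar>n\<bar> + 1" by (simp add: m_def)
      then have "arrival_prob R n (sgn n * int (Suc m)) (sgn n * int m) = delay down_weight (H m)"
        unfolding arrival_target down_weight_def by (simp only:)
      then show ?thesis
        using H_step[of m k] by (simp add: 0 f_def arrival_other del: of_nat_Suc)
    next
      case (Suc i)
      then show ?thesis
        using H_step[of "m + j" k] by (simp add: f_def arrival_other del: of_nat_Suc)
    qed
  qed
  then show ?thesis by (simp add: f_def)
qed

text \<open>Linear interpolation between 0, where the excursion has ended, and \<open>n\<close>,
  where the boundary value includes the arrival from below.\<close>

lemma H_below:
  assumes "j \<le> m"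
  shows "(if j = m then delay up_weight (H m) k else H j k)
    = (1 - real j / real m) * of_bool (k = 0) + real j / real m * delay up_weight (H m) k"
proof -
  define f where "f j = (if j = m then delay up_weight (H m) k else H j k)" for j
  have "f j = (1 - real j / real m) * f 0 + real j / real m * f m"
  proof (rule harmonic_nat_linear[OF _ assms m_pos])
    fix i assume i: "Suc i < m"
    show "f (Suc i) = (f i + f (Suc (Suc i))) / 2"
    proof (cases "Suc (Suc i) = m")
      case True
      then have "int (Suc i) = \<bar>n\<bar> - 1" by (simp add: m_def)
      then have "arrival_prob R n (sgn n * int (Suc i)) (sgn n * int m) = delay up_weight (H m)"
        unfolding arrival_target up_weight_def by (simp only:)
      then show ?thesis
        using H_step[of i k] i True by (simp add: f_def arrival_other del: of_nat_Suc)
    next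
      case False
      then show ?thesis
        using H_step[of i k] i by (simp add: f_def arrival_other del: of_nat_Suc)
    qed
  qed
  moreover have "f 0 = of_bool (k = 0)" using m_pos by (simp add: f_def H_def)
  ultimately show ?thesis by (simp add: f_def)
qed

text \<open>The first step from \<open>n\<close> leads to distance \<open>m + 1\<close>, where
  \<open>H_above\<close> applies, or to \<open>m - 1\<close>, where interpolation gives weight
  \<open>1 / m\<close> to 0.\<close>

lemma H_target:
  "H m k = (delay down_weight (H m) k
    + ((1 / m) * of_bool (k = 0) + (1 - 1 / m) * delay up_weight (H m) k)) / 2"
proof -
  obtain i where i: "m = Suc i" using m_pos by (cases m) auto
  have "H m k = (H (Suc m) k + H i k) / 2"
    using H_step[of i k] by (simp add: i[symmetric] arrival_other del: of_nat_Suc) (simp add: i arrival_other)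
  moreover have "H i k = (1 / m) * of_bool (k = 0) + (1 - 1 / m) * delay up_weight (H m) k"
    using H_below[of i k] by (simp add: i field_simps)
  ultimately show ?thesis by (simp add: H_above)
qed

text \<open>
  The law is bounded harmonic on the other side of \<open>0\<close> as well. This avoids an almost sure
  argument that the walk cannot jump over \<open>0\<close>.
\<close>

lemma passage_prob_opposite: "passage_prob R n (- (sgn n * int j)) k = of_bool (k = 0)"
proof -
  define f where "f j = passage_prob R n (- (sgn n * int j)) k" for j
  \<comment> \<open>None of these sites is \<open>n\<close>, so no arrival at them is
    counted.\<close>
  have other: "arrival_prob R n a (- (sgn n * int j)) k = f j" for a j
    unfolding f_def by (subst arrival_prob_other) (use n in \<open>cases "0 < n"; auto\<close>)+
  have "f j = f 0"
  proof (rule bounded_harmonic_nat_const)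
    show "\<bar>f j\<bar> \<le> 1" for j
      unfolding f_def by (rule abs_passage_prob_le)
    show "f (Suc j) = (f j + f (Suc (Suc j))) / 2" for j
    proof -
      let ?a = "- (sgn n * int (Suc j))"
      have "f (Suc j) = (arrival_prob R n ?a (- (sgn n * int j)) k
          + arrival_prob R n ?a (- (sgn n * int (Suc (Suc j)))) k) / 2"
        unfolding f_def using n passage_prob_step[OF n, of ?a R k]
        by (cases "0 < n") (simp_all add: algebra_simps)
      then show ?thesis unfolding other .
    qed
  qed
  then show ?thesis by (simp add: f_def)
qed

text \<open>Half the mass steps away from \<open>n\<close> and never counts a passage. The other
  half reaches distance 1 on the side of \<open>n\<close>, where \<open>H_below\<close>
  applies.\<close>

lemma passages_from_0:
  "measure coins {x. passages R n (walk 0 x) = enat k} = 1 / 2 * of_bool (k = 0)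
    + 1 / 2 * ((1 - 1 / m) * of_bool (k = 0) + (1 / m) * delay up_weight (H m) k)"
proof -
  have "measure coins {x. passages R n (walk 0 x) = enat k}
      = (arrival_prob R n 0 (sgn n) k + arrival_prob R n 0 (- sgn n) k) / 2"
    using passages_first_step[OF n, of R 0 k] n by (cases "0 < n") simp_all
  also have "arrival_prob R n 0 (- sgn n) k = of_bool (k = 0)"
    using passage_prob_opposite[of 1 k] n by (subst arrival_prob_other) (cases "0 < n"; auto)+
  also have "arrival_prob R n 0 (sgn n) k = (if 1 = m then delay up_weight (H m) k else H 1 k)"
  \<comment> \<open>If \<open>m = 1\<close>, the first step lands on \<open>n\<close> and is itself
    an arrival from distance 0.\<close>
  proof (cases "m = 1")
    case True
    then have "\<bar>n\<bar> - 1 = 0" by (simp add: m_def)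
    then show ?thesis
      using arrival_target[of 0] True by (simp add: up_weight_def)
  next
    case False
    then show ?thesis using arrival_other[of 1 0] by simp
  qed
  also have "\<dots> = (1 - 1 / m) * of_bool (k = 0) + (1 / m) * delay up_weight (H m) k"
    using H_below[of 1 k] m_pos by simp
  finally show ?thesis by (simp add: field_simps)
qed

text \<open>\<open>H_target\<close> becomes a linear equation for the sum \<open>A\<close>, whose
  existence follows by comparison with a geometric series.\<close>

lemma H_pgf:
  fixes t :: real
  assumes t: "\<bar>t\<bar> < 1"
  shows "(\<lambda>k. H m k * t ^ k) sums (1 / (2 * m - m * t ^ down_weight - (m - 1) * t ^ up_weight))"
proof -
  have "summable (\<lambda>k. H m k * t ^ k)"
  proof (rule summable_comparison_test')
    show "summable (\<lambda>k. \<bar>t\<bar> ^ k)" using t by (simp add: summable_geometric)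
    show "norm (H m k * t ^ k) \<le> \<bar>t\<bar> ^ k" for k
      using abs_passage_prob_le[of R n _ k]
      by (simp add: H_def abs_mult power_abs mult_left_le_one_le)
  qed
  then obtain A where A: "(\<lambda>k. H m k * t ^ k) sums A" by blast
  have del: "(\<lambda>k. delay d (H m) k * t ^ k) sums (t ^ d * A)" for d
    by (rule sums_delayed[OF A])
  have "(\<lambda>k. (delay down_weight (H m) k * t ^ k + ((1 / m) * (of_bool (k = 0) * t ^ k)
      + (1 - 1 / m) * (delay up_weight (H m) k * t ^ k))) / 2)
    sums ((t ^ down_weight * A + ((1 / m) * 1 + (1 - 1 / m) * (t ^ up_weight * A))) / 2)"
    by (intro sums_divide sums_add sums_mult del of_bool_0_sums)
  moreover have "(delay down_weight (H m) k * t ^ k + ((1 / m) * (of_bool (k = 0) * t ^ k)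
      + (1 - 1 / m) * (delay up_weight (H m) k * t ^ k))) / 2 = H m k * t ^ k" for k
    by (subst H_target) (simp add: algebra_simps add_divide_distrib)
  ultimately have "(\<lambda>k. H m k * t ^ k)
      sums ((t ^ down_weight * A + ((1 / m) * 1 + (1 - 1 / m) * (t ^ up_weight * A))) / 2)"
    by (simp only:)
  then have "A = (t ^ down_weight * A + ((1 / m) * 1 + (1 - 1 / m) * (t ^ up_weight * A))) / 2"
    by (rule sums_unique2[OF A])
  then have "A * (2 * m - m * t ^ down_weight - (m - 1) * t ^ up_weight) = 1"
    using m_pos by (simp add: field_simps of_nat_diff)
  \<comment> \<open>A product equal to 1 has no zero factor, so division is allowed.\<close>
  then have "A = 1 / (2 * m - m * t ^ down_weight - (m - 1) * t ^ up_weight)"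
    by (metis mult_zero_right nonzero_eq_divide_eq zero_neq_one)
  then show ?thesis using A by simp
qed

end

lemma passage_law:
  fixes M :: "'a measure" and N :: "'b measure"
  assumes walk: "simple_symmetric_walk M S"
    and branching: "galton_watson N (\<lambda>k. 1 / 2 ^ (k + 1)) \<xi> Z"
    and n: "n \<noteq> 0"
  shows "\<P>(\<omega> in M. passages R n (\<lambda>t. S t \<omega>) = enat k) = 1 / 2 * of_bool (k = 0) + 1 / 2 *
    \<P>(\<omega> in N. of_bool (R (\<bar>n\<bar> - 1)) * Z (nat \<bar>n\<bar> - 1) \<omega> + of_bool (R (\<bar>n\<bar> + 1)) * Z (nat \<bar>n\<bar>) \<omega> = k)"
proof -
  interpret M: simple_symmetric_walk M S by (rule walk)
  interpret N: geometric_galton_watson N \<xi> Z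
    unfolding geometric_galton_watson_def by (rule branching)
  interpret passage_target R n by unfold_locales (rule n)
  note N.random_Z[measurable]
  obtain i where i: "m = Suc i" using m_pos by (cases m) auto
  define Y where "Y \<omega> = up_weight * Z i \<omega> + down_weight * Z (Suc i) \<omega>" for \<omega>
  have Y[measurable]: "Y \<in> measurable N (count_space UNIV)"
    unfolding Y_def by measurable
  \<comment> \<open>The law of the count after a first step towards \<open>n\<close>, read off from
    \<open>passages_from_0\<close>.\<close>
  define c where "c k = (1 - 1 / m) * of_bool (k = 0) + (1 / m) * delay up_weight (H m) k" for k
  have "c = (\<lambda>k. \<P>(\<omega> in N. Y \<omega> = k))"
  proof (rule power_series_unique)
    fix t :: real assume t: "\<bar>t\<bar> < 1"
    let ?s = "t ^ up_weight" and ?u = "t ^ down_weight"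
    define D where "D = 2 * m - m * ?u - i * ?s"
    have bounds: "\<bar>?s\<bar> \<le> 1" "\<bar>?u\<bar> \<le> 1"
      using t by (auto simp: power_abs intro: power_le_one)
    have "N.expectation (\<lambda>\<omega>. t ^ Y \<omega>) = N.expectation (\<lambda>\<omega>. ?s ^ Z i \<omega> * ?u ^ Z (Suc i) \<omega>)"
      by (simp add: Y_def power_add power_mult)
    also have "\<dots> = 1 - (2 - ?u - ?s) / D"
      by (subst N.consecutive_pgf[OF bounds]) (simp add: D_def i algebra_simps)
    finally show "(\<lambda>k. \<P>(\<omega> in N. Y \<omega> = k) * t ^ k) sums (1 - (2 - ?u - ?s) / D)"
      using N.pgf_sums[OF Y, of t] t by simp
    have A: "(\<lambda>k. H m k * t ^ k) sums (1 / D)"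
      using H_pgf[OF t] by (simp add: D_def i)
    have "(\<lambda>k. (1 - 1 / m) * (of_bool (k = 0) * t ^ k) + (1 / m) * (delay up_weight (H m) k * t ^ k))
        sums ((1 - 1 / m) * 1 + (1 / m) * (?s * (1 / D)))"
      by (intro sums_add sums_mult of_bool_0_sums sums_delayed A)
    moreover have "(1 - 1 / m) * 1 + (1 / m) * (?s * (1 / D)) = 1 - (2 - ?u - ?s) / D"
    proof -
      define X where "X = 2 - ?u - ?s"
      \<comment> \<open>With this identity \<open>?s / (m * D)\<close> equals
        \<open>1 / m - X / D\<close>, and the terms \<open>1 / m\<close> cancel.\<close>
      have s: "?s = D - m * X" by (simp add: D_def X_def i algebra_simps)
      have "0 < D"
      proof -
        have "m * ?u \<le> m" "i * ?s \<le> i" "real m = real i + 1"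
          using bounds by (simp_all add: mult_left_le i)
        then show ?thesis unfolding D_def by linarith
      qed
      then show ?thesis
        unfolding X_def[symmetric] unfolding s using m_pos by (simp add: field_simps)
    qed
    moreover have "c k * t ^ k = (1 - 1 / m) * (of_bool (k = 0) * t ^ k)
        + (1 / m) * (delay up_weight (H m) k * t ^ k)" for k
      by (simp add: c_def algebra_simps)
    ultimately show "(\<lambda>k. c k * t ^ k) sums (1 - (2 - ?u - ?s) / D)"
      by (simp only:)
  qed
  then have "c k = \<P>(\<omega> in N. Y \<omega> = k)" by (rule fun_cong)
  then show ?thesis
    using M.prob_passages passages_from_0[of k] i
    by (simp add: c_def Y_def up_weight_def down_weight_def m_def)
qed

theorem proposition4p1:
  fixes M :: "'a measure" and S :: "nat \<Rightarrow> 'a \<Rightarrow> int"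
    and N :: "'b measure" and \<xi> :: "nat \<Rightarrow> nat \<Rightarrow> 'b \<Rightarrow> nat" and Z :: "nat \<Rightarrow> 'b \<Rightarrow> nat"
    and n :: int
  assumes walk: "simple_symmetric_walk M S"
    and branching: "galton_watson N (\<lambda>k. 1 / 2 ^ (k + 1)) \<xi> Z"
    and n: "n \<noteq> 0"
  shows "(\<forall>k\<ge>1.
      \<P>(\<omega> in M. up_crossings S n \<omega> = enat k)
        = 1 / 2 * \<P>(\<omega> in N. Z (nat \<bar>n\<bar> - 1) \<omega> = k) \<and>
      \<P>(\<omega> in M. down_crossings S n \<omega> = enat k)
        = 1 / 2 * \<P>(\<omega> in N. Z (nat \<bar>n\<bar>) \<omega> = k) \<and>
      \<P>(\<omega> in M. visits S n \<omega> = enat k)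
        = 1 / 2 * \<P>(\<omega> in N. Z (nat \<bar>n\<bar> - 1) \<omega> + Z (nat \<bar>n\<bar>) \<omega> = k)) \<and>
    \<P>(\<omega> in M. up_crossings S n \<omega> = 0)
      = 1 / 2 + 1 / 2 * \<P>(\<omega> in N. Z (nat \<bar>n\<bar> - 1) \<omega> = 0) \<and>
    \<P>(\<omega> in M. down_crossings S n \<omega> = 0)
      = 1 / 2 + 1 / 2 * \<P>(\<omega> in N. Z (nat \<bar>n\<bar>) \<omega> = 0) \<and>
    \<P>(\<omega> in M. visits S n \<omega> = 0)
      = 1 / 2 + 1 / 2 * \<P>(\<omega> in N. Z (nat \<bar>n\<bar> - 1) \<omega> + Z (nat \<bar>n\<bar>) \<omega> = 0)"
proof -
  interpret M: simple_symmetric_walk M S by (rule walk)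
  \<comment> \<open>The three choices of \<open>R\<close> give the weights (1, 0), (0, 1) and (1, 1)
    for \<open>Z (m - 1)\<close> and \<open>Z m\<close>, where \<open>m\<close> is |n|.\<close>
  have up: "up_crossings S n \<omega> = passages (\<lambda>i. i = \<bar>n\<bar> - 1) n (\<lambda>t. S t \<omega>)" for \<omega>
    by (simp add: up_crossings_def passages_def less_return_time_iff conj_ac)
  have down: "down_crossings S n \<omega> = passages (\<lambda>i. i = \<bar>n\<bar> + 1) n (\<lambda>t. S t \<omega>)" for \<omega>
    by (simp add: down_crossings_def passages_def less_return_time_iff conj_ac)
  have all: "visits S n \<omega> = passages (\<lambda>_. True) n (\<lambda>t. S t \<omega>)" for \<omega>
    by (simp add: visits_def passages_def less_return_time_iff conj_ac)
  note law = passage_law[OF walk branching n]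
  show ?thesis
    unfolding up down all zero_enat_def law by simp
qed

end
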